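(* Let $D$ be a finite distributive lattice and let $Q \subseteq D$. If $Q$ is principal congruence representable, then $Q$ is chain representable.
   Context: For a finite lattice $L$, $\operatorname{Con} L$ denotes the congruence lattice of $L$. For $x, y \in L$, $\operatorname{con}(x,y)$ denotes the smallest congruence of $L$ identifying $x$ and $y$; congruences of this form are called principal, and $\operatorname{Princ} L \subseteq \operatorname{Con} L$ denotes the set of all principal congruences of $L$ (this includes the zero congruence $\operatorname{con}(x,x)$). For a finite distributive lattice $D$, a subset $Q \subseteq D$ is called principal congruence representable (briefly, representable) if there exist a finite lattice $L$ and a lattice isomorphism $\varphi \colon D \to \operatorname{Con} L$ such that $\varphi(Q) = \operatorname{Princ} L$. $\operatorname{J}(D)$ denotes the ordered set of (nonzero) join-irreducible elements of $D$. For a finite chain $C$, $\operatorname{Prime} C$ denotes the set of prime intervals of $C$, that is, intervals $[x,y]$ of $C$ in which $y$ covers $x$. The chain $C$ is colored by an ordered set $P$ if there is given a map $\operatorname{col}$ of $\operatorname{Prime} C$ onto $P$ (surjective; no other condition is imposed). For $x \le y$ in $C$, the color set of $[x,y]$ is $$\operatorname{colSet}[x,y] = \{\operatorname{col}(\mathfrak p) \mid \mathfrak p \text{ is a prime interval of } C \text{ contained in } [x,y]\};$$ in particular $\operatorname{colSet}[x,x] = \varnothing$. If $C$ is a finite chain colored by $P = \operatorname{J}(D)$, define $\operatorname{Rep}[x,y] = \bigvee \operatorname{colSet}[x,y] \in D$ for $x \le y$ in $C$ (join formed in $D$, the empty join being the zero of $D$), and $$\operatorname{Rep} C = \{\operatorname{Rep}[x,y]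 \mid x \le y \text{ in } C\} \subseteq D.$$ A subset $Q \subseteq D$ is called (colored-)chain representable if there is a finite (nonempty) chain $C$ colored by $\operatorname{J}(D)$ such that $Q = \operatorname{Rep} C$. *)

theory Defs
  imports "HOL-Algebra.Lattice"
begin

section \<open>Finite lattices, finite distributive lattices and finite chains\<close>

text \<open>
  The locales \<^locale>\<open>lattice\<close> and \<^locale>\<open>total_order\<close> of HOL-Algebra admit an empty
  carrier, so nonemptiness is required separately.
\<close>

locale finite_lattice = lattice +
  assumes finite_carrier: "finite (carrier L)"
    and carrier_nonempty: "carrier L \<noteq> {}"

locale finite_distributive_lattice = finite_lattice +
  assumes meet_join_distrib:
    "\<lbrakk>x \<in> carrier L; y \<in> carrier L; z \<in> carrier L\<rbrakk>
      \<Longrightarrow> x \<sqinter> (y \<squnion> z) = (x \<sqinter> y) \<squnion> (x \<sqinter> z)"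

locale finite_chain = total_order +
  assumes finite_carrier: "finite (carrier L)"
    and carrier_nonempty: "carrier L \<noteq> {}"

definition lattice_iso :: "('a, 'm) gorder_scheme \<Rightarrow> ('b, 'n) gorder_scheme \<Rightarrow> ('a \<Rightarrow> 'b) \<Rightarrow> bool"
  where "lattice_iso A B f \<longleftrightarrow>
    bij_betw f (carrier A) (carrier B) \<and> join_pres A B f \<and> meet_pres A B f"

definition join_irreducibles :: "('a, 'm) gorder_scheme \<Rightarrow> 'a set"
  where "join_irreducibles D =
    {a \<in> carrier D. a \<noteq> \<bottom>\<^bsub>D\<^esub> \<and>
      (\<forall>x \<in> carrier D. \<forall>y \<in> carrier D. a = x \<squnion>\<^bsub>D\<^esub> y \<longrightarrow> a = x \<or> a = y)}"


section \<open>Congruences\<close>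

definition congruence :: "('a, 'm) gorder_scheme \<Rightarrow> 'a rel \<Rightarrow> bool"
  where "congruence L \<theta> \<longleftrightarrow>
    equiv (carrier L) \<theta> \<and>
    (\<forall>x y u v. (x, y) \<in> \<theta> \<longrightarrow> (u, v) \<in> \<theta> \<longrightarrow>
      (x \<squnion>\<^bsub>L\<^esub> u, y \<squnion>\<^bsub>L\<^esub> v) \<in> \<theta> \<and> (x \<sqinter>\<^bsub>L\<^esub> u, y \<sqinter>\<^bsub>L\<^esub> v) \<in> \<theta>)"

definition Con :: "('a, 'm) gorder_scheme \<Rightarrow> 'a rel gorder"
  where "Con L = \<lparr>carrier = {\<theta>. congruence L \<theta>}, eq = (=), le = (\<subseteq>)\<rparr>"

definition con :: "('a, 'm) gorder_scheme \<Rightarrow> 'a \<Rightarrow> 'a \<Rightarrow> 'a rel"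
  where "con L x y = \<Inter> {\<theta>. congruence L \<theta> \<and> (x, y) \<in> \<theta>}"

definition Princ :: "('a, 'm) gorder_scheme \<Rightarrow> 'a rel set"
  where "Princ L = {con L x y | x y. x \<in> carrier L \<and> y \<in> carrier L}"

lemma (in lattice) congruence_total: "congruence L (carrier L \<times> carrier L)"
  unfolding congruence_def by (auto intro!: equivI simp: refl_on_def sym_def trans_def)

lemma congruence_Inter:
  assumes "T \<noteq> {}" and cong: "\<And>\<theta>. \<theta> \<in> T \<Longrightarrow> congruence L \<theta>"
  shows "congruence L (\<Inter> T)"
  unfolding congruence_def
proof (intro conjI allI impI)
  have eqv: "\<theta> \<subseteq> carrier L \<times> carrier L" "refl_on (carrier L) \<theta>" "sym \<theta>" "trans \<theta>"
    if "\<theta> \<in> T" for \<theta>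
    using cong[OF that] by (auto simp: congruence_def equiv_def)
  show "equiv (carrier L) (\<Inter> T)"
  proof (rule equivI)
    show "\<Inter> T \<subseteq> carrier L \<times> carrier L" using eqv(1) \<open>T \<noteq> {}\<close> by blast
    show "refl_on (carrier L) (\<Inter> T)" using eqv(2) by (auto simp: refl_on_def)
    show "sym (\<Inter> T)" using eqv(3) by (auto simp: sym_def)
    show "trans (\<Inter> T)" using eqv(4) unfolding trans_def by blast
  qed
qed (use cong in \<open>auto simp: congruence_def\<close>)

lemma (in lattice) con_least:
  assumes "x \<in> carrier L" "y \<in> carrier L"
  shows "least (Con L) (con L x y) {\<theta> \<in> carrier (Con L). (x, y) \<in> \<theta>}"
proof -
  have "congruence L (con L x y)"
    unfolding con_def using congruence_total assms by (intro congruence_Inter) auto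
  then show ?thesis
    by (auto simp: least_def Con_def con_def)
qed

lemma (in lattice) Con_lattice: "lattice (Con L)"
proof -
  have po: "partial_order (Con L)"
    by unfold_locales (auto simp: Con_def)
  show ?thesis
  proof (intro lattice.intro upper_semilattice.intro lower_semilattice.intro
      upper_semilattice_axioms.intro lower_semilattice_axioms.intro po)
    fix \<alpha> \<beta> assume ab: "\<alpha> \<in> carrier (Con L)" "\<beta> \<in> carrier (Con L)"
    let ?T = "{\<theta>. congruence L \<theta> \<and> \<alpha> \<subseteq> \<theta> \<and> \<beta> \<subseteq> \<theta>}"
    have "carrier L \<times> carrier L \<in> ?T"
      using congruence_total ab by (auto simp: Con_def congruence_def equiv_def)
    then have "congruence L (\<Inter> ?T)"
      by (intro congruence_Inter) auto
    then show "\<exists>s. least (Con L) s (Upper (Con L) {\<alpha>, \<beta>})"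
      using ab by (intro exI[of _ "\<Inter> ?T"]) (auto simp: least_def Upper_def Con_def)
    have "congruence L (\<Inter> {\<alpha>, \<beta>})"
      using ab by (intro congruence_Inter) (auto simp: Con_def)
    then show "\<exists>s. greatest (Con L) s (Lower (Con L) {\<alpha>, \<beta>})"
      using ab by (intro exI[of _ "\<alpha> \<inter> \<beta>"]) (auto simp: greatest_def Lower_def Con_def)
  qed
qed

text \<open>
  The type argument is the type over which the lattice \<open>L\<close> ranges, since HOL has no
  quantification over types inside formulas. Every finite lattice is isomorphic to one whose
  carrier is a set of natural numbers, so the instance \<open>nat\<close> is implied by every other one.
  A theorem that assumes this predicate for an arbitrary \<open>'l\<close> covers lattices over all types.
\<close>

definition principal_congruence_representable ::
    "'l itself \<Rightarrow> ('d, 'm) gorder_scheme \<Rightarrow> 'd set \<Rightarrow> bool"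
  where "principal_congruence_representable TYPE('l) D Q \<longleftrightarrow>
    (\<exists>(L :: 'l gorder) \<phi>. finite_lattice L \<and> lattice_iso D (Con L) \<phi> \<and> \<phi> ` Q = Princ L)"


section \<open>Colored chains\<close>

definition covers :: "('a, 'm) gorder_scheme \<Rightarrow> 'a \<Rightarrow> 'a \<Rightarrow> bool"
  where "covers C y x \<longleftrightarrow>
    x \<in> carrier C \<and> y \<in> carrier C \<and> x \<sqsubset>\<^bsub>C\<^esub> y \<and>
    \<not> (\<exists>z \<in> carrier C. x \<sqsubset>\<^bsub>C\<^esub> z \<and> z \<sqsubset>\<^bsub>C\<^esub> y)"

definition Prime :: "('a, 'm) gorder_scheme \<Rightarrow> 'a set set"
  where "Prime C = {\<lbrace>x..y\<rbrace>\<^bsub>C\<^esub> | x y. covers C y x}"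

definition colored_by :: "('a, 'm) gorder_scheme \<Rightarrow> ('a set \<Rightarrow> 'd) \<Rightarrow> 'd set \<Rightarrow> bool"
  where "colored_by C col P \<longleftrightarrow> col ` Prime C = P"

definition colSet :: "('a, 'm) gorder_scheme \<Rightarrow> ('a set \<Rightarrow> 'd) \<Rightarrow> 'a \<Rightarrow> 'a \<Rightarrow> 'd set"
  where "colSet C col x y = {col p | p. p \<in> Prime C \<and> p \<subseteq> \<lbrace>x..y\<rbrace>\<^bsub>C\<^esub>}"

text \<open>The supremum of the empty set in \<open>D\<close> is the least element of \<open>D\<close>.\<close>

definition Rep ::
    "('d, 'n) gorder_scheme \<Rightarrow> ('a, 'm) gorder_scheme \<Rightarrow> ('a set \<Rightarrow> 'd) \<Rightarrow> 'a \<Rightarrow> 'a \<Rightarrow> 'd"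
  where "Rep D C col x y = \<Squnion>\<^bsub>D\<^esub> (colSet C col x y)"

definition Rep_set ::
    "('d, 'n) gorder_scheme \<Rightarrow> ('a, 'm) gorder_scheme \<Rightarrow> ('a set \<Rightarrow> 'd) \<Rightarrow> 'd set"
  where "Rep_set D C col =
    {Rep D C col x y | x y. x \<in> carrier C \<and> y \<in> carrier C \<and> x \<sqsubseteq>\<^bsub>C\<^esub> y}"

text \<open>
  Every finite chain is isomorphic to one whose carrier is a set of natural numbers, so
  restricting \<open>C\<close> to that type loses nothing.
\<close>

definition chain_representable :: "('d, 'm) gorder_scheme \<Rightarrow> 'd set \<Rightarrow> bool"
  where "chain_representable D Q \<longleftrightarrow>
    (\<exists>(C :: nat gorder) col.
      finite_chain C \<and> colored_by C col (join_irreducibles D) \<and> Q = Rep_set D C col)"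

end

theory Submission
  imports Defs "HOL-Library.Sublist"
begin

text \<open>
  Represent \<open>D\<close> as \<open>Con L\<close> and walk along the covering edges of \<open>L\<close>, alternately up from \<open>0\<close> to
  \<open>1\<close> and down from \<open>1\<close> to \<open>0\<close>, such that every interval \<open>[x, y]\<close> of \<open>L\<close> is traversed by some
  ascent. The edges of the walk, colored by the congruences they generate, form the chain.
  The congruence generated by a segment of the walk is always principal: if the segment is
  monotone from \<open>x\<close> to \<open>y\<close>, it is \<open>con(x, y)\<close>; if it has a single turn, say at \<open>1\<close>, and runs from
  \<open>x\<close> up to \<open>1\<close> and then down to \<open>y\<close>, it is \<open>con(x, 1) \<squnion> con(y, 1) = con(x \<sqinter> y, 1)\<close>; with two
  turns it contains a full passage between \<open>0\<close> and \<open>1\<close> and so generates the unit congruence.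
\<close>

section \<open>Congruences of a lattice\<close>

lemma congruenceD:
  assumes "congruence L \<theta>"
  shows congruence_carrier: "(x, y) \<in> \<theta> \<Longrightarrow> x \<in> carrier L \<and> y \<in> carrier L"
    and congruence_refl: "x \<in> carrier L \<Longrightarrow> (x, x) \<in> \<theta>"
    and congruence_sym: "(x, y) \<in> \<theta> \<Longrightarrow> (y, x) \<in> \<theta>"
    and congruence_trans: "(x, y) \<in> \<theta> \<Longrightarrow> (y, z) \<in> \<theta> \<Longrightarrow> (x, z) \<in> \<theta>"
    and congruence_join: "(x, y) \<in> \<theta> \<Longrightarrow> (u, v) \<in> \<theta> \<Longrightarrow> (x \<squnion>\<^bsub>L\<^esub> u, y \<squnion>\<^bsub>L\<^esub> v) \<in> \<theta>"
    and congruence_meet: "(x, y) \<in> \<theta> \<Longrightarrow> (u, v) \<in> \<theta> \<Longrightarrow> (x \<sqinter>\<^bsub>L\<^esub> u, y \<sqinter>\<^bsub>L\<^esub> v) \<in> \<theta>"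
  using assms unfolding congruence_def equiv_def refl_on_def sym_def trans_def by blast+

context lattice
begin

lemma congruence_Id_on: "congruence L (Id_on (carrier L))"
  unfolding congruence_def
  by (auto intro!: equivI simp: refl_on_def sym_def trans_def)

lemma congruence_con:
  "x \<in> carrier L \<Longrightarrow> y \<in> carrier L \<Longrightarrow> congruence L (con L x y)"
  using con_least[of x y] by (auto simp: least_def Con_def)

lemma con_mem: "(x, y) \<in> con L x y"
  by (auto simp: con_def)

lemma con_subset_iff: "congruence L \<theta> \<Longrightarrow> con L x y \<subseteq> \<theta> \<longleftrightarrow> (x, y) \<in> \<theta>"
  unfolding con_def by blast

section \<open>Reduction of congruences to comparable pairs and intervals\<close>

lemma meet_le_join: "x \<in> carrier L \<Longrightarrow> y \<in> carrier L \<Longrightarrow> x \<sqinter> y \<sqsubseteq> x \<squnion> y"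
  using meet_left join_left le_trans by (meson join_closed meet_closed)

text \<open>Forward, meeting and joining \<open>(x, y)\<close> with \<open>(x, x)\<close> relates
  \<open>x\<close> to both \<open>x \<sqinter> y\<close> and \<open>x \<squnion> y\<close>.
  Backward, joining the given pair with \<open>x\<close> and with \<open>y\<close> relates both to
  \<open>x \<squnion> y\<close>. Principal congruences thus come from comparable pairs, which a walk
  along edges can reach.\<close>

lemma congruence_meet_join_iff:
  assumes "congruence L \<theta>" and c: "x \<in> carrier L" "y \<in> carrier L"
  shows "(x \<sqinter> y, x \<squnion> y) \<in> \<theta> \<longleftrightarrow> (x, y) \<in> \<theta>"
proof
  note C = congruenceD[OF assms(1)]
  have idem: "x \<squnion> x = x" "x \<sqinter> x = x" if "x \<in> carrier L" for x
    using that le_refl le_iff_join le_iff_meet by metis+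
  show "(x \<sqinter> y, x \<squnion> y) \<in> \<theta>" if "(x, y) \<in> \<theta>"
  proof -
    have "(x \<sqinter> y, x \<sqinter> x) \<in> \<theta>" "(x \<squnion> x, x \<squnion> y) \<in> \<theta>"
      using that c by (blast intro: C)+
    then show ?thesis using c by (auto simp: idem intro: C(4))
  qed
  show "(x, y) \<in> \<theta>" if h: "(x \<sqinter> y, x \<squnion> y) \<in> \<theta>"
  proof -
    have eq: "(x \<sqinter> y) \<squnion> z = z" "(x \<squnion> y) \<sqinter> z = z" if "z = x \<or> z = y" for z
      using that c meet_left meet_right join_left join_right le_iff_meet le_iff_join meet_comm
      by (metis join_closed meet_closed)+
    have "((x \<sqinter> y) \<squnion> z, (x \<squnion> y) \<squnion> z) \<in> \<theta>" if "z \<in> carrier L" for z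
      using h that by (blast intro: C)
    moreover have "(x \<squnion> y) \<squnion> z = x \<squnion> y" if "z = x \<or> z = y" for z
      using that c join_left join_right le_iff_meet join_comm by (metis join_closed)
    ultimately have "(x, x \<squnion> y) \<in> \<theta>" "(y, x \<squnion> y) \<in> \<theta>"
      using c eq by metis+
    then show ?thesis by (blast intro: C)
  qed
qed

text \<open>Convexity: joining \<open>(a, b)\<close> with \<open>x\<close> gives
  \<open>(x, b)\<close>, and meeting that with \<open>y\<close> gives \<open>(x, y)\<close>.\<close>

lemma congruence_interval:
  assumes "congruence L \<theta>" "(a, b) \<in> \<theta>" "x \<in> carrier L" "y \<in> carrier L"
    and "a \<sqsubseteq> x" "x \<sqsubseteq> y" "y \<sqsubseteq> b"
  shows "(x, y) \<in> \<theta>"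
proof -
  note C = congruenceD[OF assms(1)]
  have ab: "a \<in> carrier L" "b \<in> carrier L" using assms(2) C(1) by auto
  have "x \<sqsubseteq> b" using assms ab le_trans by blast
  then have "a \<squnion> x = x" "b \<squnion> x = b"
    using assms ab le_iff_meet join_comm by metis+
  moreover have "(a \<squnion> x, b \<squnion> x) \<in> \<theta>" using assms by (blast intro: C)
  ultimately have "(x \<sqinter> y, b \<sqinter> y) \<in> \<theta>" using assms by (auto intro: C)
  moreover have "x \<sqinter> y = x" "b \<sqinter> y = y"
    using assms ab le_iff_join meet_comm by metis+
  ultimately show ?thesis by simp
qed

text \<open>The relation \<open>(\<alpha> \<union> \<beta>)\<^sup>+\<close> is the join of \<open>\<alpha>\<close> and \<open>\<beta>\<close> in \<open>Con L\<close>.\<close>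

lemma congruence_trancl_Un:
  assumes "congruence L \<alpha>" "congruence L \<beta>"
  shows "congruence L ((\<alpha> \<union> \<beta>)\<^sup>+)"
proof -
  note A = congruenceD[OF assms(1)] and B = congruenceD[OF assms(2)]
  let ?R = "(\<alpha> \<union> \<beta>)\<^sup>+"
  have car: "x \<in> carrier L \<and> y \<in> carrier L" if "(x, y) \<in> ?R" for x y
    using that by (induction rule: trancl_induct) (auto dest: A(1) B(1))
  have refl: "(x, x) \<in> ?R" if "x \<in> carrier L" for x
    using that A(2) by auto
  have "sym (\<alpha> \<union> \<beta>)"
    using A(3) B(3) by (auto simp: sym_def)
  then have sym: "sym ?R"
    by (rule sym_trancl)
  \<comment> \<open>Compatibility is shown once for a commutative \<open>f\<close>: translating a
    path by a fixed element keeps each step in \<alpha> or \<beta>, so the two arguments can be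
    changed one at a time.\<close>
  have comp: "(f x u, f y v) \<in> ?R"
    if f: "\<And>x y u. (x, y) \<in> \<alpha> \<union> \<beta> \<Longrightarrow> u \<in> carrier L \<Longrightarrow> (f x u, f y u) \<in> \<alpha> \<union> \<beta>"
      and comm: "\<And>x y. f x y = f y x"
      and xy: "(x, y) \<in> ?R" and uv: "(u, v) \<in> ?R" for f x y u v
  proof -
    have one: "(f x u, f y u) \<in> ?R" if "(x, y) \<in> ?R" "u \<in> carrier L" for x y u
      using that(1)
    proof (induction rule: trancl_induct)
      case (base y)
      then show ?case using f that(2) by blast
    next
      case (step y z)
      then show ?case using f[OF step(2) that(2)] by (auto intro: trancl_into_trancl)
    qed
    have "(f x u, f y u) \<in> ?R" using one xy uv car by blast
    moreover have "(f u y, f v y) \<in> ?R" using one xy uv car by blast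
    ultimately show ?thesis using comm by (metis trancl_trans)
  qed
  have "(x \<squnion> u, y \<squnion> v) \<in> ?R" if "(x, y) \<in> ?R" "(u, v) \<in> ?R" for x y u v
    using comp[where f = "join L", OF _ join_comm that] A(2,5) B(2,5) by blast
  moreover have "(x \<sqinter> u, y \<sqinter> v) \<in> ?R" if "(x, y) \<in> ?R" "(u, v) \<in> ?R" for x y u v
    using comp[where f = "meet L", OF _ meet_comm that] A(2,6) B(2,6) by blast
  moreover have "equiv (carrier L) ?R"
    by (rule equivI) (use car refl sym in \<open>auto simp: refl_on_def\<close>)
  ultimately show ?thesis
    unfolding congruence_def by blast
qed

text \<open>The map \<open>r\<close> sends \<open>L\<close> into the two-element interval from
  \<open>a\<close> to \<open>b\<close>, fixes both ends and respects every congruence. Along a path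
  of \<alpha>- and \<beta>-steps from \<open>a\<close> to \<open>b\<close> its value must change at
  some step, and that step puts \<open>(a, b)\<close> into \<alpha> or \<beta>. This is why edges
  generate join-irreducible congruences.\<close>

lemma covers_trancl_Un:
  assumes "congruence L \<alpha>" "congruence L \<beta>" and cov: "covers L b a"
    and "(a, b) \<in> (\<alpha> \<union> \<beta>)\<^sup>+"
  shows "(a, b) \<in> \<alpha> \<or> (a, b) \<in> \<beta>"
proof (rule ccontr)
  assume neg: "\<not> ?thesis"
  note A = congruenceD[OF assms(1)] and B = congruenceD[OF assms(2)]
  have ab: "a \<in> carrier L" "b \<in> carrier L" "a \<sqsubseteq> b" "a \<noteq> b"
    using cov by (auto simp: covers_def lless_eq)
  define r where "r z = (z \<squnion> a) \<sqinter> b" for z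
  have r_ab: "r z = a \<or> r z = b" if "z \<in> carrier L" for z
  proof -
    have "r z \<in> carrier L" "a \<sqsubseteq> r z" "r z \<sqsubseteq> b"
      using that ab join_right meet_le meet_right by (auto simp: r_def)
    then show ?thesis using cov by (auto simp: covers_def lless_eq)
  qed
  have step: "r z = a \<longleftrightarrow> r z' = a" if "(z, z') \<in> \<alpha> \<union> \<beta>" for z z'
  proof -
    have "(r z, r z') \<in> \<theta>" if "congruence L \<theta>" "(z, z') \<in> \<theta>" for \<theta>
      unfolding r_def
      using that ab by (intro congruence_join congruence_meet congruence_refl)
    then have "(r z, r z') \<in> \<alpha> \<union> \<beta>"
      using that assms(1,2) by auto
    moreover have "z \<in> carrier L" "z' \<in> carrier L"
      using that A(1) B(1) by auto
    then have "r z = a \<or> r z = b" "r z' = a \<or> r z' = b"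
      using r_ab by auto
    ultimately show ?thesis
      using neg A(3)[of b a] B(3)[of b a] by auto
  qed
  have "r a = a \<longleftrightarrow> r b = a"
    using assms(4) by (induction rule: trancl_induct) (use step in blast)+
  moreover have "a \<squnion> a = a" "a \<sqinter> b = a" "b \<squnion> a = b" "b \<sqinter> b = b"
    using ab le_refl le_iff_meet le_iff_join join_comm by metis+
  ultimately show False using ab by (simp add: r_def)
qed

end

section \<open>Extremal elements and join-irreducibles of a finite lattice\<close>

context finite_lattice
begin

lemma ex_least: "\<exists>x. least L x (carrier L)"
  using finite_inf_greatest[OF finite_carrier subset_refl carrier_nonempty]
  by (auto simp: least_def greatest_def Lower_def)

lemma ex_greatest: "\<exists>x. greatest L x (carrier L)"
  using finite_sup_least[OF finite_carrier subset_refl carrier_nonempty]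
  by (auto simp: least_def greatest_def Upper_def)

lemma bottom_least: "least L \<bottom> (carrier L)"
  unfolding bottom_def using ex_least by (rule someI_ex)

text \<open>Elements strictly below \<open>d\<close> are closed under binary joins because
  \<open>d\<close> is join-irreducible, and \<open>\<bottom>\<close> is one of them because
  \<open>d\<close> is nonzero. Finite induction then bounds all of them by a single one.\<close>

lemma join_irreducible_lower_cover:
  assumes "d \<in> join_irreducibles L"
  obtains e where "e \<in> carrier L" "e \<sqsubset> d" "\<And>x. x \<in> carrier L \<Longrightarrow> x \<sqsubset> d \<Longrightarrow> x \<sqsubseteq> e"
proof -
  have d: "d \<in> carrier L" "d \<noteq> \<bottom>"
    and ji: "\<And>x y. x \<in> carrier L \<Longrightarrow> y \<in> carrier L \<Longrightarrow> d = x \<squnion> y \<Longrightarrow> d = x \<or> d = y"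
    using assms by (auto simp: join_irreducibles_def)
  have bound: "\<exists>e \<in> carrier L. e \<sqsubset> d \<and> (\<forall>x \<in> A. x \<sqsubseteq> e)"
    if "finite A" "A \<subseteq> {x \<in> carrier L. x \<sqsubset> d}" for A
    using that
  proof (induction rule: finite_induct)
    case empty
    have "\<bottom> \<sqsubseteq> d" "\<bottom> \<in> carrier L"
      using bottom_least d by (auto simp: least_def)
    then show ?case using d by (auto simp: lless_eq intro!: bexI[of _ "\<bottom>"])
  next
    case (insert x A)
    then obtain e where e: "e \<in> carrier L" "e \<sqsubset> d" "\<forall>x \<in> A. x \<sqsubseteq> e" by auto
    have x: "x \<in> carrier L" "x \<sqsubset> d" using insert by auto
    have "x \<squnion> e \<sqsubseteq> d" using x e d by (auto simp: lless_eq intro: join_le)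
    moreover have "x \<squnion> e \<noteq> d" using ji[of x e] x e by (auto simp: lless_eq)
    moreover have "y \<sqsubseteq> x \<squnion> e" if "y \<in> A" for y
      using le_trans[of y e "x \<squnion> e"] that insert.prems e x join_right by auto
    ultimately show ?case
      using x e join_left by (intro bexI[of _ "x \<squnion> e"]) (auto simp: lless_eq)
  qed
  show thesis
    using bound[of "{x \<in> carrier L. x \<sqsubset> d}"] finite_carrier that by auto
qed

end


section \<open>Saturated chains\<close>

text \<open>The list consists of the consecutive covering pairs of a maximal chain of \<open>[x, y]\<close>.\<close>

inductive saturated :: "('a, 'm) gorder_scheme \<Rightarrow> 'a \<Rightarrow> 'a \<Rightarrow> ('a \<times> 'a) list \<Rightarrow> bool"
  for L where
  saturated_Nil: "x \<in> carrier L \<Longrightarrow> saturated L x x []"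
| saturated_Cons: "covers L y x \<Longrightarrow> saturated L y z es \<Longrightarrow> saturated L x z ((x, y) # es)"

lemma saturated_covers: "saturated L x y es \<Longrightarrow> (a, b) \<in> set es \<Longrightarrow> covers L b a"
  by (induction rule: saturated.induct) auto

lemma saturated_append_iff:
  "saturated L x z (es @ fs) \<longleftrightarrow> (\<exists>y. saturated L x y es \<and> saturated L y z fs)"
proof (induction es arbitrary: x)
  case Nil
  have "x \<in> carrier L" if "saturated L x z fs"
    using that by cases (auto simp: covers_def)
  then show ?case
    by (auto intro: saturated_Nil elim: saturated.cases)
next
  case (Cons e es)
  show ?case
    unfolding append_Cons
    by (subst (1 2) saturated.simps) (auto simp: Cons.IH)
qed

text \<open>
  The congruence generated by the pairs in \<open>es\<close> is \<open>con(x, y)\<close>, expressed through the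
  congruences containing it so that no joins in \<open>Con L\<close> are needed.
\<close>

definition generates :: "('a, 'm) gorder_scheme \<Rightarrow> ('a \<times> 'a) list \<Rightarrow> 'a \<Rightarrow> 'a \<Rightarrow> bool"
  where "generates L es x y \<longleftrightarrow> x \<in> carrier L \<and> y \<in> carrier L \<and>
    (\<forall>\<theta>. congruence L \<theta> \<longrightarrow> set es \<subseteq> \<theta> \<longleftrightarrow> (x, y) \<in> \<theta>)"

text \<open>A descent is stored as a reversed ascent whose pairs still point upwards; only the set
  of pairs matters for the congruence.\<close>

lemma generates_rev [simp]: "generates L (rev es) = generates L es"
  by (simp add: generates_def fun_eq_iff)

section \<open>Saturated chains and the congruences they generate\<close>

context finite_lattice
begin

lemma saturated_le:
  "saturated L x y es \<Longrightarrow> x \<in> carrier L \<and> y \<in> carrier L \<and> x \<sqsubseteq> y"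
  by (induction rule: saturated.induct) (auto simp: covers_def lless_eq intro: le_trans)

text \<open>For a chain from \<open>x\<close> through \<open>y\<close> to \<open>z\<close>,
  convexity and transitivity make \<open>(x, z) \<in> \<theta>\<close> equivalent to having both
  parts in \<theta>; the empty chain is reflexivity.\<close>

lemma saturated_generates:
  assumes "saturated L x y es"
  shows "generates L es x y"
proof -
  have "set es \<subseteq> \<theta> \<longleftrightarrow> (x, y) \<in> \<theta>" if "congruence L \<theta>" for \<theta>
    using assms
  proof (induction rule: saturated.induct)
    case (saturated_Nil x)
    then show ?case using that congruence_refl by auto
  next
    case (saturated_Cons y x z es)
    have "x \<in> carrier L" "y \<in> carrier L" "x \<sqsubseteq> y" "z \<in> carrier L" "y \<sqsubseteq> z"
      using saturated_Cons saturated_le by (auto simp: covers_def lless_eq)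
    then have "(x, z) \<in> \<theta> \<longleftrightarrow> (x, y) \<in> \<theta> \<and> (y, z) \<in> \<theta>"
      using that congruence_interval[OF that, of x z] le_refl congruence_trans[OF that] by blast
    then show ?case using saturated_Cons by auto
  qed
  then show ?thesis using saturated_le[OF assms] by (simp add: generates_def)
qed

text \<open>Induction on the size of the interval: cutting at a strictly intermediate
  \<open>z\<close> leaves a lower part without \<open>y\<close> and an upper part without
  \<open>x\<close>.\<close>

lemma ex_saturated:
  assumes "x \<in> carrier L" "y \<in> carrier L" "x \<sqsubseteq> y"
  shows "\<exists>es. saturated L x y es"
  using assms
proof (induction "card \<lbrace>x..y\<rbrace>" arbitrary: x y rule: less_induct)
  case less
  consider "x = y" | "covers L y x" | z where "z \<in> carrier L" "x \<sqsubset> z" "z \<sqsubset> y"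
    using less.prems by (auto simp: covers_def lless_eq)
  then show ?case
  proof cases
    case 1
    then show ?thesis using less.prems saturated_Nil by metis
  next
    case 2
    then show ?thesis using less.prems saturated_Nil saturated_Cons by metis
  next
    case (3 z)
    have fin: "finite \<lbrace>x..y\<rbrace>"
      using finite_carrier by (auto simp: at_least_at_most_def)
    have z: "x \<sqsubseteq> z" "z \<sqsubseteq> y" "\<not> z \<sqsubseteq> x" "\<not> y \<sqsubseteq> z"
      using 3 less.prems le_antisym by (auto simp: lless_eq)
    have "\<lbrace>x..z\<rbrace> \<subset> \<lbrace>x..y\<rbrace>"
      using z 3 less.prems by (auto simp: at_least_at_most_def intro: le_trans)
    moreover have "\<lbrace>z..y\<rbrace> \<subset> \<lbrace>x..y\<rbrace>"
      using z 3 less.prems by (auto simp: at_least_at_most_def intro: le_trans)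
    ultimately have "\<exists>es. saturated L x z es" "\<exists>es. saturated L z y es"
      using less.hyps less.prems fin z 3 by (simp_all add: psubset_card_mono)
    then show ?thesis using saturated_append_iff by metis
  qed
qed


section \<open>The walk\<close>

text \<open>Contiguous segments of the walk become intervals of the colored chain, so this is the
  invariant that makes every value of \<open>Rep\<close> principal.\<close>

definition principal_segments :: "('a \<times> 'a) list \<Rightarrow> bool"
  where "principal_segments es \<longleftrightarrow> (\<forall>s. sublist s es \<longrightarrow> (\<exists>x y. generates L s x y))"

text \<open>By convexity, identifying bottom and top identifies everything, so a further segment
  adds nothing.\<close>

lemma generates_full:
  assumes "least L z (carrier L)" "greatest L t (carrier L)"
    and "generates L es z t" "generates L fs x y"
  shows "generates L (es @ fs) z t"
proof -
  have "(x, y) \<in> \<theta>" if "congruence L \<theta>" "(z, t) \<in> \<theta>" for \<theta>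
  proof -
    have xy: "x \<in> carrier L" "y \<in> carrier L" using assms by (auto simp: generates_def)
    then have "(z, x) \<in> \<theta>" "(z, y) \<in> \<theta>"
      using assms that congruence_interval[OF that] by (auto simp: least_def greatest_def)
    then show ?thesis using congruence_sym congruence_trans that(1) by metis
  qed
  then show ?thesis using assms by (auto simp: generates_def)
qed

text \<open>Meeting \<open>(x, t)\<close> with \<open>(y, t)\<close> gives
  \<open>(x \<sqinter> y, t)\<close>; convexity gives the converse.\<close>

lemma generates_turn_top:
  assumes "greatest L t (carrier L)" "generates L es x t" "generates L fs y t"
  shows "generates L (es @ fs) (x \<sqinter> y) t"
proof -
  have c: "x \<in> carrier L" "y \<in> carrier L" "t \<in> carrier L" "x \<sqsubseteq> t" "y \<sqsubseteq> t"
    using assms by (auto simp: generates_def greatest_def)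
  have "(x \<sqinter> y, t) \<in> \<theta> \<longleftrightarrow> (x, t) \<in> \<theta> \<and> (y, t) \<in> \<theta>" if "congruence L \<theta>" for \<theta>
  proof
    show "(x \<sqinter> y, t) \<in> \<theta>" if "(x, t) \<in> \<theta> \<and> (y, t) \<in> \<theta>"
      using congruence_meet[OF \<open>congruence L \<theta>\<close>, of x t y t] that c le_iff_join[of t t] by simp
  qed (use congruence_interval[OF that, of "x \<sqinter> y" t] c meet_left meet_right in auto)
  then show ?thesis using assms c by (auto simp: generates_def)
qed

text \<open>Dual to the turn at the top, with joins in place of meets.\<close>

lemma generates_turn_bottom:
  assumes "least L z (carrier L)" "generates L es z x" "generates L fs z y"
  shows "generates L (es @ fs) z (x \<squnion> y)"
proof -
  have c: "x \<in> carrier L" "y \<in> carrier L" "z \<in> carrier L" "z \<sqsubseteq> x" "z \<sqsubseteq> y"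
    using assms by (auto simp: generates_def least_def)
  have "(z, x \<squnion> y) \<in> \<theta> \<longleftrightarrow> (z, x) \<in> \<theta> \<and> (z, y) \<in> \<theta>" if "congruence L \<theta>" for \<theta>
  proof
    show "(z, x \<squnion> y) \<in> \<theta>" if "(z, x) \<in> \<theta> \<and> (z, y) \<in> \<theta>"
      using congruence_join[OF \<open>congruence L \<theta>\<close>, of z x z y] that c le_iff_meet[of z z] by simp
  qed (use congruence_interval[OF that, of z "x \<squnion> y"] c join_left join_right in auto)
  then show ?thesis using assms c by (auto simp: generates_def)
qed

text \<open>Here \<open>E\<close> continues the walk from the top. A prefix of \<open>es @ E\<close>
  either stops inside the ascent or contains all of it and generates the unit congruence. A segment
  across the junction is a suffix of the ascent and a prefix of \<open>E\<close>, combined by the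
  turn at the top. The hypothesis on prefixes of \<open>E\<close> absorbs all later turns, so none
  have to be counted.\<close>

lemma walk_ascend:
  assumes zt: "least L z (carrier L)" "greatest L t (carrier L)" and es: "saturated L z t es"
    and E: "\<And>p. prefix p E \<Longrightarrow> \<exists>x. generates L p x t" "principal_segments E"
  shows "prefix p (es @ E) \<Longrightarrow> \<exists>x. generates L p z x" and "principal_segments (es @ E)"
proof -
  have split: "\<exists>x. saturated L z x p \<and> saturated L x t s" if "es = p @ s" for p s
    using es saturated_append_iff that by metis
  show "\<exists>x. generates L p z x" if "prefix p (es @ E)"
    using that unfolding prefix_append
  proof (elim disjE exE conjE)
    assume "prefix p es"
    then show ?thesis using split saturated_generates unfolding prefix_def by metis
  next
    fix us assume "p = es @ us" "prefix us E"
    then show ?thesis using E(1) generates_full[OF zt saturated_generates[OF es]] by blast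
  qed
  show "principal_segments (es @ E)"
    unfolding principal_segments_def sublist_append
  proof (intro allI impI, elim disjE exE conjE)
    fix s assume "sublist s es"
    then show "\<exists>x y. generates L s x y"
      using es saturated_generates unfolding sublist_def by (metis saturated_append_iff)
  next
    fix s assume "sublist s E"
    then show "\<exists>x y. generates L s x y" using E(2) by (simp add: principal_segments_def)
  next
    fix s s1 s2 assume "s = s1 @ s2" "suffix s1 es" "prefix s2 E"
    moreover obtain x where "generates L s1 x t"
      using split saturated_generates \<open>suffix s1 es\<close> unfolding suffix_def by metis
    moreover obtain y where "generates L s2 y t" using E(1) \<open>prefix s2 E\<close> by blast
    ultimately show "\<exists>x y. generates L s x y"
      using generates_turn_top[OF zt(2)] by blast
  qed
qed

text \<open>Dual step: \<open>E\<close> continues from the bottom, and crossing segments are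
  combined by the turn there.\<close>

lemma walk_descend:
  assumes zt: "least L z (carrier L)" "greatest L t (carrier L)" and es: "saturated L z t es"
    and E: "\<And>p. prefix p E \<Longrightarrow> \<exists>x. generates L p z x" "principal_segments E"
  shows "prefix p (rev es @ E) \<Longrightarrow> \<exists>x. generates L p x t" and "principal_segments (rev es @ E)"
proof -
  have split: "\<exists>x. generates L s z x \<and> generates L p x t" if "rev es = p @ s" for p s
  proof -
    \<comment> \<open>The part of the descent traversed first is the upper part of the ascent, hence
      the end \<open>t\<close> for \<open>p\<close> and the end \<open>z\<close> for
      \<open>s\<close>.\<close>
    have "es = rev s @ rev p" using that by (metis rev_append rev_rev_ident)
    then show ?thesis
      using es saturated_append_iff saturated_generates generates_rev by metis
  qed
  show "\<exists>x. generates L p x t" if "prefix p (rev es @ E)"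
    using that unfolding prefix_append
  proof (elim disjE exE conjE)
    assume "prefix p (rev es)"
    then show ?thesis using split unfolding prefix_def by metis
  next
    fix us assume "p = rev es @ us" "prefix us E"
    then show ?thesis
      using E(1) generates_full[OF zt, of "rev es"] saturated_generates[OF es] by fastforce
  qed
  show "principal_segments (rev es @ E)"
    unfolding principal_segments_def sublist_append
  proof (intro allI impI, elim disjE exE conjE)
    fix s assume "sublist s (rev es)"
    then obtain p q where "es = p @ rev s @ q"
      unfolding sublist_def by (metis append.assoc rev_append rev_rev_ident)
    then show "\<exists>x y. generates L s x y"
      using es saturated_generates generates_rev by (metis saturated_append_iff)
  next
    fix s assume "sublist s E"
    then show "\<exists>x y. generates L s x y" using E(2) by (simp add: principal_segments_def)
  next
    fix s s1 s2 assume "s = s1 @ s2" "suffix s1 (rev es)" "prefix s2 E"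
    moreover obtain x where "generates L s1 z x"
      using split \<open>suffix s1 (rev es)\<close> unfolding suffix_def by metis
    moreover obtain y where "generates L s2 z y" using E(1) \<open>prefix s2 E\<close> by blast
    ultimately show "\<exists>x y. generates L s x y"
      using generates_turn_bottom[OF zt(1)] by blast
  qed
qed

lemma principal_segments_walk:
  assumes zt: "least L z (carrier L)" "greatest L t (carrier L)"
    and "\<And>es. es \<in> set ess \<Longrightarrow> saturated L z t es"
  shows "principal_segments (concat (map (\<lambda>es. es @ rev es) ess))"
proof -
  let ?W = "\<lambda>ess. concat (map (\<lambda>es. es @ rev es) ess)"
  \<comment> \<open>The claim is strengthened by the prefix condition at the bottom, which
    \<open>walk_descend\<close> requires of the remaining walk; each round starts and ends at
    \<open>z\<close>.\<close>
  have "(\<forall>p. prefix p (?W ess) \<longrightarrow> (\<exists>x. generates L p z x)) \<and> principal_segments (?W ess)"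
    using assms(3)
  proof (induction ess)
    case Nil
    have "generates L [] z z"
      using zt by (auto simp: generates_def least_def congruence_refl)
    then show ?case by (auto simp: principal_segments_def)
  next
    case (Cons es ess)
    then have es: "saturated L z t es" by simp
    show ?case
      using walk_ascend[OF zt es, of "rev es @ ?W ess"] walk_descend[OF zt es, of "?W ess"] Cons
      by auto
  qed
  then show ?thesis by simp
qed

text \<open>Each comparable pair gets its own maximal chain of \<open>L\<close> through both
  elements. The walk goes up and down these chains in turn, so every interval is traversed by some
  ascent.\<close>

lemma ex_walk:
  obtains es where "\<And>a b. (a, b) \<in> set es \<Longrightarrow> covers L b a" "principal_segments es"
    "\<And>x y. x \<in> carrier L \<Longrightarrow> y \<in> carrier L \<Longrightarrow> x \<sqsubseteq> y \<Longrightarrow> \<exists>s. sublist s es \<and> generates L s x y"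
proof -
  obtain z t where zt: "least L z (carrier L)" "greatest L t (carrier L)"
    using ex_least ex_greatest by blast
  let ?P = "{(x, y). x \<in> carrier L \<and> y \<in> carrier L \<and> x \<sqsubseteq> y}"
  have "\<forall>e \<in> ?P. \<exists>es. saturated L z t es \<and>
      (\<exists>s. sublist s es \<and> generates L s (fst e) (snd e))"
  proof
    fix e assume "e \<in> ?P"
    then obtain x y where xy: "e = (x, y)" "x \<in> carrier L" "y \<in> carrier L" "x \<sqsubseteq> y" by auto
    then have "z \<sqsubseteq> x" "y \<sqsubseteq> t" "z \<in> carrier L" "t \<in> carrier L"
      using zt by (auto simp: least_def greatest_def)
    then obtain p s q where "saturated L z x p" "saturated L x y s" "saturated L y t q"
      using xy ex_saturated[of z x] ex_saturated[of x y] ex_saturated[of y t] by auto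
    then have "saturated L z t (p @ s @ q)" "generates L s x y"
      using saturated_append_iff saturated_generates by metis+
    then show "\<exists>es. saturated L z t es \<and> (\<exists>s. sublist s es \<and> generates L s (fst e) (snd e))"
      unfolding xy by auto
  qed
  from bchoice[OF this] obtain f where f: "\<forall>e \<in> ?P. saturated L z t (f e) \<and>
      (\<exists>s. sublist s (f e) \<and> generates L s (fst e) (snd e))"
    by (rule exE)
  have "?P \<subseteq> carrier L \<times> carrier L" by auto
  then have "finite ?P"
    using finite_carrier finite_subset by blast
  from finite_list[OF this] obtain ps where ps: "set ps = ?P"
    by (rule exE)
  define ess where "ess = map f ps"
  have sat: "saturated L z t es" if "es \<in> set ess" for es
    using that f ps by (auto simp: ess_def)
  define W where "W = concat (map (\<lambda>es. es @ rev es) ess)"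
  have "covers L b a" if "(a, b) \<in> set W" for a b
    using that sat saturated_covers unfolding W_def by fastforce
  moreover have "principal_segments W"
    unfolding W_def using principal_segments_walk[OF zt sat] .
  moreover have "\<exists>s. sublist s W \<and> generates L s x y"
    if "x \<in> carrier L" "y \<in> carrier L" "x \<sqsubseteq> y" for x y
  proof -
    have xy: "(x, y) \<in> ?P" using that by simp
    then have "f (x, y) \<in> set ess" using ps by (simp add: ess_def)
    then obtain us vs where "ess = us @ f (x, y) # vs" by (meson split_list)
    then have "sublist (f (x, y)) W" unfolding W_def by simp
    then show ?thesis using bspec[OF f xy] sublist_order.order_trans by auto
  qed
  ultimately show thesis by (rule that)
qed

end


section \<open>Chains of natural numbers\<close>

text \<open>The parameter counts prime intervals, not elements: \<open>n\<close> colors fit the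
  chain on \<open>{..n}\<close>, and \<open>n = 0\<close> is the one-element chain.\<close>

definition nat_chain :: "nat \<Rightarrow> nat gorder"
  where "nat_chain n = \<lparr>carrier = {..n}, eq = (=), le = (\<le>)\<rparr>"

lemma finite_chain_nat_chain: "finite_chain (nat_chain n)"
  by unfold_locales (auto simp: nat_chain_def)

lemma covers_nat_chain: "covers (nat_chain n) j i \<longleftrightarrow> j = Suc i \<and> j \<le> n"
proof
  assume "covers (nat_chain n) j i"
  then have "i < j" "j \<le> n" "\<forall>k \<le> n. i < k \<longrightarrow> \<not> k < j"
    by (auto simp: covers_def nat_chain_def lless_def nat_less_le)
  then show "j = Suc i \<and> j \<le> n" by (auto dest: spec[of _ "Suc i"])
qed (auto simp: covers_def nat_chain_def lless_def)

lemma interval_nat_chain: "j \<le> n \<Longrightarrow> \<lbrace>i..j\<rbrace>\<^bsub>nat_chain n\<^esub> = {i..j}"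
  by (auto simp: at_least_at_most_def nat_chain_def)

lemma Prime_nat_chain: "Prime (nat_chain n) = {{i..Suc i} | i. i < n}"
proof (intro equalityI subsetI)
  fix p assume "p \<in> Prime (nat_chain n)"
  then obtain i where "Suc i \<le> n" "p = \<lbrace>i..Suc i\<rbrace>\<^bsub>nat_chain n\<^esub>"
    by (auto simp: Prime_def covers_nat_chain)
  then show "p \<in> {{i..Suc i} | i. i < n}"
    using interval_nat_chain by auto
next
  fix p assume "p \<in> {{i..Suc i} | i. i < n}"
  then obtain i where i: "Suc i \<le> n" "p = {i..Suc i}" by auto
  then have "p = \<lbrace>i..Suc i\<rbrace>\<^bsub>nat_chain n\<^esub>" "covers (nat_chain n) (Suc i) i"
    using interval_nat_chain covers_nat_chain by auto
  then show "p \<in> Prime (nat_chain n)"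
    unfolding Prime_def by blast
qed

text \<open>A coloring takes a prime interval as a set, so its position in the list is recovered as
  its minimum.\<close>

definition list_col :: "'d list \<Rightarrow> nat set \<Rightarrow> 'd"
  where "list_col cs p = cs ! Min p"

lemma list_col_prime [simp]: "list_col cs {i..Suc i} = cs ! i"
  unfolding list_col_def by (subst Min_eqI[of _ i]) auto

lemma colored_by_list_col: "colored_by (nat_chain (length cs)) (list_col cs) (set cs)"
proof -
  have "list_col cs ` Prime (nat_chain (length cs)) = {cs ! i | i. i < length cs}"
    unfolding Prime_nat_chain by (force simp: image_iff)
  then show ?thesis by (auto simp: colored_by_def set_conv_nth)
qed

lemma colSet_list_col:
  assumes "cs = p @ s @ q"
  shows "colSet (nat_chain (length cs)) (list_col cs) (length p) (length p + length s) = set s"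
proof -
  let ?i = "length p" and ?j = "length p + length s"
  have j: "?j \<le> length cs" using assms by simp
  have "colSet (nat_chain (length cs)) (list_col cs) ?i ?j
      = {cs ! k | k. k < length cs \<and> {k..Suc k} \<subseteq> {?i..?j}}"
    (is "_ = ?R")
  proof (intro equalityI subsetI)
    fix c assume "c \<in> colSet (nat_chain (length cs)) (list_col cs) ?i ?j"
    then obtain k where "c = list_col cs {k..Suc k}" "k < length cs" "{k..Suc k} \<subseteq> {?i..?j}"
      unfolding colSet_def interval_nat_chain[OF j] Prime_nat_chain by blast
    then show "c \<in> ?R" by auto
  next
    fix c assume "c \<in> ?R"
    then obtain k where "c = list_col cs {k..Suc k}" "k < length cs" "{k..Suc k} \<subseteq> {?i..?j}"
      by auto
    then show "c \<in> colSet (nat_chain (length cs)) (list_col cs) ?i ?j"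
      unfolding colSet_def interval_nat_chain[OF j] Prime_nat_chain by blast
  qed
  \<comment> \<open>The upper end \<open>Suc k\<close> must not exceed \<open>?j\<close>, hence the
    strict bound on \<open>k\<close>.\<close>
  also have "\<dots> = {cs ! k | k. ?i \<le> k \<and> k < ?j}"
    using j by auto
  also have "\<dots> = {s ! k | k. k < length s}"
  proof (intro equalityI subsetI)
    fix c assume "c \<in> {cs ! k | k. ?i \<le> k \<and> k < ?j}"
    then obtain k where "c = cs ! k" "?i \<le> k" "k < ?j" by auto
    then show "c \<in> {s ! k | k. k < length s}"
      using assms by (intro CollectI exI[of _ "k - ?i"]) (auto simp: nth_append)
  next
    fix c assume "c \<in> {s ! k | k. k < length s}"
    then obtain k where "c = s ! k" "k < length s" by auto
    then show "c \<in> {cs ! k | k. ?i \<le> k \<and> k < ?j}"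
      using assms by (intro CollectI exI[of _ "?i + k"]) (auto simp: nth_append)
  qed
  also have "\<dots> = set s" by (auto simp: set_conv_nth)
  finally show ?thesis .
qed

text \<open>The interval from \<open>i\<close> to \<open>j\<close> corresponds to the segment of
  length \<open>j - i\<close> starting at position \<open>i\<close>; the case \<open>i = j\<close>
  is the empty segment with the empty join.\<close>

lemma Rep_set_list_col:
  "Rep_set D (nat_chain (length cs)) (list_col cs) = {\<Squnion>\<^bsub>D\<^esub> (set s) | s. sublist s cs}"
proof (intro equalityI subsetI)
  fix d assume "d \<in> Rep_set D (nat_chain (length cs)) (list_col cs)"
  then obtain i j where ij: "i \<le> j" "j \<le> length cs"
    and d: "d = Rep D (nat_chain (length cs)) (list_col cs) i j"
    by (auto simp: Rep_set_def nat_chain_def)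
  define s where "s = take (j - i) (drop i cs)"
  have cs: "cs = take i cs @ s @ drop j cs"
    using ij by (metis append_take_drop_id drop_drop le_add_diff_inverse2 s_def)
  have "length (take i cs) = i" "length (take i cs) + length s = j"
    using ij by (auto simp: s_def)
  then have "d = \<Squnion>\<^bsub>D\<^esub> (set s)"
    using colSet_list_col[OF cs] d by (simp add: Rep_def)
  then show "d \<in> {\<Squnion>\<^bsub>D\<^esub> (set s) | s. sublist s cs}"
    using cs unfolding sublist_def by blast
next
  fix d assume "d \<in> {\<Squnion>\<^bsub>D\<^esub> (set s) | s. sublist s cs}"
  then obtain p s q where cs: "cs = p @ s @ q" and d: "d = \<Squnion>\<^bsub>D\<^esub> (set s)"
    by (auto simp: sublist_def)
  have "d = Rep D (nat_chain (length cs)) (list_col cs) (length p) (length p + length s)"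
    using colSet_list_col[OF cs] d by (simp add: Rep_def)
  moreover have "length p + length s \<le> length cs" using cs by simp
  ultimately show "d \<in> Rep_set D (nat_chain (length cs)) (list_col cs)"
    unfolding Rep_set_def nat_chain_def by fastforce
qed


section \<open>Transfer along the representation\<close>

lemma (in partial_order) sup_eqI: "least L d (Upper L S) \<Longrightarrow> \<Squnion> S = d"
  unfolding sup_def by (rule some_equality) (auto intro: least_unique)

text \<open>The order is encoded in joins, since \<open>x \<sqsubseteq> y\<close> means that the
  join of \<open>x\<close> and \<open>y\<close> is \<open>y\<close>; injectivity reflects this
  equation.\<close>

lemma lattice_iso_le_iff:
  assumes "lattice_iso A B f" "x \<in> carrier A" "y \<in> carrier A"
  shows "x \<sqsubseteq>\<^bsub>A\<^esub> y \<longleftrightarrow> f x \<sqsubseteq>\<^bsub>B\<^esub> f y"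
proof -
  interpret A: lattice A using assms by (simp add: lattice_iso_def join_pres_def)
  interpret B: lattice B using assms by (simp add: lattice_iso_def join_pres_def)
  have f: "f x \<in> carrier B" "f y \<in> carrier B" "inj_on f (carrier A)"
    using assms by (auto simp: lattice_iso_def bij_betw_def)
  have "f (x \<squnion>\<^bsub>A\<^esub> y) = f x \<squnion>\<^bsub>B\<^esub> f y"
    using assms by (auto simp: lattice_iso_def join_pres_def)
  then show ?thesis
    using f assms A.le_iff_meet[of x y] B.le_iff_meet[of "f x" "f y"]
    by (metis A.join_closed inj_on_eq_iff)
qed

section \<open>Coloring the edges of the lattice by elements of \<open>D\<close>\<close>

locale congruence_representation =
  D: finite_lattice D + L: finite_lattice L
  for D :: "'d gorder" and L :: "'l gorder" +
  fixes \<phi> :: "'d \<Rightarrow> 'l rel"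
  assumes iso: "lattice_iso D (Con L) \<phi>"
begin

lemma congruence_\<phi>: "d \<in> carrier D \<Longrightarrow> congruence L (\<phi> d)"
  using iso by (auto simp: lattice_iso_def bij_betw_def Con_def)

lemma ex_preimage:
  assumes "congruence L \<theta>"
  shows "\<exists>d \<in> carrier D. \<phi> d = \<theta>"
proof -
  have "\<phi> ` carrier D = {\<theta>. congruence L \<theta>}"
    using iso by (simp add: lattice_iso_def bij_betw_def Con_def)
  then have "\<theta> \<in> \<phi> ` carrier D" using assms by simp
  then show ?thesis by blast
qed

lemma inj_\<phi>: "inj_on \<phi> (carrier D)"
  using iso by (auto simp: lattice_iso_def bij_betw_def)

lemma le_iff: "d \<in> carrier D \<Longrightarrow> e \<in> carrier D \<Longrightarrow> d \<sqsubseteq>\<^bsub>D\<^esub> e \<longleftrightarrow> \<phi> d \<subseteq> \<phi> e"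
  using lattice_iso_le_iff[OF iso] by (simp add: Con_def)

text \<open>On covering pairs this colors the walk; on arbitrary pairs of elements of
  \<open>L\<close> it enumerates the elements of \<open>D\<close> that represent principal
  congruences.\<close>

definition edge_color :: "'l \<times> 'l \<Rightarrow> 'd"
  where "edge_color e = inv_into (carrier D) \<phi> (con L (fst e) (snd e))"

lemma edge_color:
  assumes "a \<in> carrier L" "b \<in> carrier L"
  shows "edge_color (a, b) \<in> carrier D" "\<phi> (edge_color (a, b)) = con L a b"
proof -
  have "con L a b \<in> \<phi> ` carrier D"
    using ex_preimage[OF L.congruence_con[OF assms]] by (auto simp: image_iff)
  then show "edge_color (a, b) \<in> carrier D" "\<phi> (edge_color (a, b)) = con L a b"
    by (simp_all add: edge_color_def inv_into_into f_inv_into_f)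
qed

text \<open>If the color is a join of \<open>x\<close> and \<open>y\<close>, then
  \<open>(a, b)\<close> lies in every congruence above \<open>\<phi> x\<close> and
  \<open>\<phi> y\<close>, hence by \<open>covers_trancl_Un\<close> in one of these two. The color
  is nonzero because the identity congruence separates \<open>a\<close> and
  \<open>b\<close>.\<close>

lemma join_irreducible_edge_color:
  assumes cov: "covers L b a"
  shows "edge_color (a, b) \<in> join_irreducibles D"
proof -
  have ab: "a \<in> carrier L" "b \<in> carrier L" "a \<noteq> b"
    using cov by (auto simp: covers_def lless_def)
  let ?d = "edge_color (a, b)"
  note d = edge_color[OF ab(1,2)]
  have "?d \<noteq> \<bottom>\<^bsub>D\<^esub>"
  proof
    assume "?d = \<bottom>\<^bsub>D\<^esub>"
    moreover obtain e where e: "e \<in> carrier D" "\<phi> e = Id_on (carrier L)"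
      using ex_preimage L.congruence_Id_on by blast
    ultimately have "?d \<sqsubseteq>\<^bsub>D\<^esub> e"
      using D.bottom_least by (auto simp: least_def)
    then have "con L a b \<subseteq> Id_on (carrier L)"
      using le_iff d e by simp
    then show False using ab L.con_mem[of a b] by auto
  qed
  moreover have "?d = x \<or> ?d = y"
    if xy: "x \<in> carrier D" "y \<in> carrier D" and eq: "?d = x \<squnion>\<^bsub>D\<^esub> y" for x y
  proof -
    let ?\<theta> = "(\<phi> x \<union> \<phi> y)\<^sup>+"
    note c = congruence_\<phi>[OF xy(1)] congruence_\<phi>[OF xy(2)]
    obtain e where e: "e \<in> carrier D" "\<phi> e = ?\<theta>"
      using ex_preimage L.congruence_trancl_Un[OF c] by blast
    have "x \<sqsubseteq>\<^bsub>D\<^esub> e" "y \<sqsubseteq>\<^bsub>D\<^esub> e"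
      using le_iff xy e by auto
    then have "?d \<sqsubseteq>\<^bsub>D\<^esub> e"
      unfolding eq using D.join_le xy e by simp
    then have "(a, b) \<in> ?\<theta>"
      using le_iff d e L.con_mem by blast
    then have "(a, b) \<in> \<phi> x \<or> (a, b) \<in> \<phi> y"
      using L.covers_trancl_Un[OF c cov] by simp
    then have "?d \<sqsubseteq>\<^bsub>D\<^esub> x \<or> ?d \<sqsubseteq>\<^bsub>D\<^esub> y"
      using le_iff d xy L.con_subset_iff c by simp
    moreover have "x \<sqsubseteq>\<^bsub>D\<^esub> ?d" "y \<sqsubseteq>\<^bsub>D\<^esub> ?d"
      unfolding eq using D.join_left D.join_right xy by auto
    ultimately show ?thesis
      using D.le_antisym d xy by blast
  qed
  ultimately show ?thesis
    using d by (auto simp: join_irreducibles_def)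
qed

text \<open>An element \<open>d\<close> bounds the colors of \<open>s\<close> iff
  \<open>\<phi> d\<close> contains all pairs of \<open>s\<close>, iff it contains
  \<open>(x, y)\<close>, iff \<open>d\<close> lies above \<open>edge_color (x, y)\<close>.\<close>

lemma sup_edge_colors:
  assumes s: "\<And>a b. (a, b) \<in> set s \<Longrightarrow> covers L b a" and gen: "generates L s x y"
  shows "\<Squnion>\<^bsub>D\<^esub> (edge_color ` set s) = edge_color (x, y)"
proof (rule D.sup_eqI)
  have xy: "x \<in> carrier L" "y \<in> carrier L" using gen by (auto simp: generates_def)
  have col: "edge_color e \<in> carrier D" "\<phi> (edge_color e) = con L (fst e) (snd e)"
    if "e \<in> set s" for e
    using that s[of "fst e" "snd e"] edge_color[of "fst e" "snd e"] by (auto simp: covers_def)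
  have up: "d \<in> Upper D (edge_color ` set s) \<longleftrightarrow> edge_color (x, y) \<sqsubseteq>\<^bsub>D\<^esub> d"
    if d: "d \<in> carrier D" for d
  proof -
    note c = congruence_\<phi>[OF d]
    have "d \<in> Upper D (edge_color ` set s) \<longleftrightarrow> (\<forall>e \<in> set s. edge_color e \<sqsubseteq>\<^bsub>D\<^esub> d)"
      using d col by (auto simp: Upper_def)
    also have "\<dots> \<longleftrightarrow> set s \<subseteq> \<phi> d"
      using col d le_iff L.con_subset_iff[OF c] by auto
    also have "\<dots> \<longleftrightarrow> edge_color (x, y) \<sqsubseteq>\<^bsub>D\<^esub> d"
      using gen c d le_iff edge_color[OF xy] L.con_subset_iff[OF c] by (simp add: generates_def)
    finally show ?thesis .
  qed
  have "Upper D (edge_color ` set s) \<subseteq> carrier D" by (rule Upper_closed)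
  then show "least D (edge_color (x, y)) (Upper D (edge_color ` set s))"
    unfolding least_def using up edge_color[OF xy] D.le_refl by blast
qed

lemma edge_color_meet_join:
  assumes "x \<in> carrier L" "y \<in> carrier L"
  shows "edge_color (x \<sqinter>\<^bsub>L\<^esub> y, x \<squnion>\<^bsub>L\<^esub> y) = edge_color (x, y)"
proof -
  have "con L (x \<sqinter>\<^bsub>L\<^esub> y) (x \<squnion>\<^bsub>L\<^esub> y) = con L x y"
    unfolding con_def using L.congruence_meet_join_iff assms by blast
  then show ?thesis by (simp add: edge_color_def)
qed

text \<open>The chain is colored by the edge colors of the walk. It remains to see that these
  exhaust the join-irreducibles and that the joins over segments are the colors of pairs.\<close>

lemma chain_representable_principal:
  "chain_representable D {edge_color (x, y) | x y. x \<in> carrier L \<and> y \<in> carrier L}"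
proof -
  obtain es where cov: "\<And>a b. (a, b) \<in> set es \<Longrightarrow> covers L b a"
    and princ: "L.principal_segments es"
    and all: "\<And>x y. x \<in> carrier L \<Longrightarrow> y \<in> carrier L \<Longrightarrow> x \<sqsubseteq>\<^bsub>L\<^esub> y \<Longrightarrow>
        \<exists>s. sublist s es \<and> generates L s x y"
    using L.ex_walk by blast
  define cs where "cs = map edge_color es"
  have sup: "\<Squnion>\<^bsub>D\<^esub> (set (map edge_color s)) = edge_color (x, y)"
    if "sublist s es" "generates L s x y" for s x y
    using sup_edge_colors[of s x y] that cov set_mono_sublist[OF that(1)] by auto
  have "set cs = join_irreducibles D"
  proof (intro equalityI subsetI)
    fix d assume ji: "d \<in> join_irreducibles D"
    then have d: "d \<in> carrier D" by (simp add: join_irreducibles_def)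
    \<comment> \<open>With \<open>e\<close> the largest element strictly below \<open>d\<close>, a
      pair in \<open>\<phi> d\<close> but not in \<open>\<phi> e\<close> yields a segment of the
      walk with an edge of the same kind. Its color is below \<open>d\<close> but not below
      \<open>e\<close>, so it equals \<open>d\<close>.\<close>
    obtain e where e: "e \<in> carrier D" "e \<sqsubset>\<^bsub>D\<^esub> d"
      "\<And>x. x \<in> carrier D \<Longrightarrow> x \<sqsubset>\<^bsub>D\<^esub> d \<Longrightarrow> x \<sqsubseteq>\<^bsub>D\<^esub> e"
      using D.join_irreducible_lower_cover[OF ji] by blast
    note cong = congruence_\<phi>[OF d] congruence_\<phi>[OF e(1)]
    have "\<not> d \<sqsubseteq>\<^bsub>D\<^esub> e"
      using e d D.le_antisym by (auto simp: D.lless_eq)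
    then have "\<not> \<phi> d \<subseteq> \<phi> e" using le_iff d e by simp
    then obtain x y where xy: "(x, y) \<in> \<phi> d" "(x, y) \<notin> \<phi> e" by auto
    then have c: "x \<in> carrier L" "y \<in> carrier L"
      using congruence_carrier[OF cong(1)] by auto
    obtain s where s: "sublist s es" "generates L s (x \<sqinter>\<^bsub>L\<^esub> y) (x \<squnion>\<^bsub>L\<^esub> y)"
      using all[of "x \<sqinter>\<^bsub>L\<^esub> y" "x \<squnion>\<^bsub>L\<^esub> y"] L.meet_le_join c by auto
    then have "set s \<subseteq> \<phi> d" "\<not> set s \<subseteq> \<phi> e"
      using xy c cong L.congruence_meet_join_iff by (simp_all add: generates_def)
    then obtain u v where uv: "(u, v) \<in> set s" "(u, v) \<notin> \<phi> e" "(u, v) \<in> \<phi> d" by auto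
    then have es: "(u, v) \<in> set es" using set_mono_sublist[OF s(1)] by auto
    then have "u \<in> carrier L" "v \<in> carrier L" using cov by (auto simp: covers_def)
    note uvc = edge_color[OF this]
    have "edge_color (u, v) \<sqsubseteq>\<^bsub>D\<^esub> d" "\<not> edge_color (u, v) \<sqsubseteq>\<^bsub>D\<^esub> e"
      using le_iff uvc e d uv L.con_subset_iff cong by simp_all
    then have "edge_color (u, v) = d"
      using e(3)[of "edge_color (u, v)"] uvc by (auto simp: D.lless_eq)
    then show "d \<in> set cs" using es unfolding cs_def by force
  next
    fix d assume "d \<in> set cs"
    then obtain a b where "(a, b) \<in> set es" "d = edge_color (a, b)"
      unfolding cs_def by auto
    then show "d \<in> join_irreducibles D"
      using cov join_irreducible_edge_color by blast
  qed
  moreover have "{edge_color (x, y) | x y. x \<in> carrier L \<and> y \<in> carrier L}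
      = Rep_set D (nat_chain (length cs)) (list_col cs)"
    unfolding Rep_set_list_col
  proof (intro equalityI subsetI)
    fix d assume "d \<in> {edge_color (x, y) | x y. x \<in> carrier L \<and> y \<in> carrier L}"
    then obtain x y where xy: "x \<in> carrier L" "y \<in> carrier L" "d = edge_color (x, y)" by auto
    then obtain s where s: "sublist s es" "generates L s (x \<sqinter>\<^bsub>L\<^esub> y) (x \<squnion>\<^bsub>L\<^esub> y)"
      using all[of "x \<sqinter>\<^bsub>L\<^esub> y" "x \<squnion>\<^bsub>L\<^esub> y"] L.meet_le_join by auto
    then have "d = \<Squnion>\<^bsub>D\<^esub> (set (map edge_color s))"
      using sup edge_color_meet_join xy by simp
    then show "d \<in> {\<Squnion>\<^bsub>D\<^esub> (set s) | s. sublist s cs}"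
      using map_mono_sublist[OF s(1)] unfolding cs_def by blast
  next
    fix d assume "d \<in> {\<Squnion>\<^bsub>D\<^esub> (set s) | s. sublist s cs}"
    \<comment> \<open>Every segment of the color list is the image of a segment of the walk.\<close>
    then obtain s where s: "sublist s es" "d = \<Squnion>\<^bsub>D\<^esub> (set (map edge_color s))"
      unfolding cs_def sublist_def by (auto simp: map_eq_append_conv append_eq_map_conv simp del: set_map)
    then obtain x y where gen: "generates L s x y"
      using princ by (auto simp: L.principal_segments_def)
    then have "x \<in> carrier L" "y \<in> carrier L" by (auto simp: generates_def)
    then show "d \<in> {edge_color (x, y) | x y. x \<in> carrier L \<and> y \<in> carrier L}"
      using sup[OF s(1) gen] s(2) by auto
  qed
  ultimately show ?thesis
    unfolding chain_representable_def
    using finite_chain_nat_chain colored_by_list_col by metis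
qed

text \<open>Both sets lie in the carrier of \<open>D\<close> and have the image
  \<open>Princ L\<close> under the injective \<phi>.\<close>

lemma Princ_preimage:
  assumes "Q \<subseteq> carrier D" "\<phi> ` Q = Princ L"
  shows "Q = {edge_color (x, y) | x y. x \<in> carrier L \<and> y \<in> carrier L}"
proof -
  have "\<phi> ` {edge_color (x, y) | x y. x \<in> carrier L \<and> y \<in> carrier L} = Princ L"
  proof (intro equalityI subsetI)
    fix \<theta> assume "\<theta> \<in> Princ L"
    then obtain x y where "x \<in> carrier L" "y \<in> carrier L" "\<theta> = \<phi> (edge_color (x, y))"
      using edge_color(2) by (auto simp: Princ_def)
    then show "\<theta> \<in> \<phi> ` {edge_color (x, y) | x y. x \<in> carrier L \<and> y \<in> carrier L}"
      by blast
  next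
    fix \<theta> assume "\<theta> \<in> \<phi> ` {edge_color (x, y) | x y. x \<in> carrier L \<and> y \<in> carrier L}"
    then obtain x y where "x \<in> carrier L" "y \<in> carrier L" "\<theta> = con L x y"
      using edge_color(2) by auto
    then show "\<theta> \<in> Princ L"
      unfolding Princ_def by blast
  qed
  moreover have "{edge_color (x, y) | x y. x \<in> carrier L \<and> y \<in> carrier L} \<subseteq> carrier D"
    using edge_color by auto
  ultimately show ?thesis
    by (intro inj_on_image_eq_iff[OF inj_\<phi>, THEN iffD1]) (simp_all only: assms)
qed

end

theorem theorem2:
  fixes D :: "'d gorder" and Q :: "'d set"
  assumes "finite_distributive_lattice D"
    and "Q \<subseteq> carrier D"
    and "principal_congruence_representable TYPE('l) D Q"
  shows "chain_representable D Q"
proof -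
  obtain L :: "'l gorder" and \<phi> where "finite_lattice L" "lattice_iso D (Con L) \<phi>"
    and Q: "\<phi> ` Q = Princ L"
    using assms(3) unfolding principal_congruence_representable_def by blast
  then interpret congruence_representation D L \<phi>
    using assms(1)
    by (simp add: congruence_representation_def congruence_representation_axioms_def
        finite_distributive_lattice_def)
  show ?thesis
    using chain_representable_principal Princ_preimage[OF assms(2) Q] by simp
qed

end
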